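(* Let $K\ge 1$, let $S$ be a discrete set, let $X\subseteq 2^S$ be a set of feasible solutions (each a finite subset of $S$), and let $o:S\to\mathcal{C}=\{\eta_1,\dots,\eta_K\}$ assign to each element of $S$ one of $K$ ordered categories $\eta_1\prec\cdots\prec\eta_K$. Then the following three subsets of $X$ are equal: (i) the set of ordinally efficient solutions of the ordinal optimization problem (OOP), i.e. of ordinally minimizing $o(x)$ over $x\in X$; (ii) the set of tail-efficient solutions of the ordinal counting optimization problem (OCOP), i.e. of minimizing $c(x)$ over $x\in X$ with respect to tail-dominance; (iii) the set of Pareto-efficient solutions of the transformed problem (TOP), i.e. of minimizing $A\cdot c(x)$ over $x\in X$ with respect to Pareto dominance, where $A=(a_{ij})\in\mathbb{R}^{K\times K}$ is given by $a_{ij}=1$ if $i\le j$ and $a_{ij}=0$ otherwise.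
   Context: Category $\eta_i$ is strictly preferred over $\eta_{i+1}$, written $\eta_i\prec\eta_{i+1}$. For a feasible solution $x=\{e_1,\dots,e_n\}\in X$ (with distinct $e_i$; $n$ may vary with $x$), $o(x)$ denotes the vector $(o(e_1),\dots,o(e_n))$ sorted from most to least preferred category, and the counting vector $c(x)\in\mathbb{Z}^K$ has components $c_i(x)=|\{e\in x: o(e)=\eta_i\}|$. Ordinal efficiency: a numerical representation is a function $\nu:\mathcal{C}\to\mathbb{Z}_{\ge 0}$ (non-negative integers) with $\eta_i\prec\eta_j\iff\nu(\eta_i)<\nu(\eta_j)$ for all $i,j$; $\mathcal{V}$ is the set of all numerical representations. Put $\nu(x)=\sum_{i=1}^n\nu(o(e_i))=\sum_{i=1}^K\nu(\eta_i)c_i(x)$. For $x',\hat x\in X$, $x'$ weakly ordinally dominates $\hat x$ if $\nu(x')\le\nu(\hat x)$ for every $\nu\in\mathcal{V}$; $x'$ ordinally dominates $\hat x$ if in addition $\nu^*(x')<\nu^*(\hat x)$ for some $\nu^*\in\mathcal{V}$. A solution $x^*\in X$ is ordinally efficient if no $x\in X$ ordinally dominates $x^*$. Tail-efficiency: $x'$ tail-dominates $\hat x$ if $\sum_{i=j}^K c_i(x')\le\sum_{i=j}^K c_i(\hat x)$ for all $j=1,\dots,K$ and $c(x')\ne c(\hat x)$. A solution $x^*\in X$ is tail-efficient if no $x\in X$ tail-dominates $x^*$. Pareto efficiency: for $u,v\in\mathbb{R}^K$, $u$ Pareto dominates $v$ if $u_i\le v_i$ for all $i$ and $u\ne v$.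 A solution $x^*\in X$ is Pareto-efficient for (TOP) if there is no $x\in X$ such that $A\cdot c(x)$ Pareto dominates $A\cdot c(x^* )$. *)

theory Defs
  imports "HOL-Analysis.Analysis"
begin

text \<open>
  The categories \<open>\<eta>\<^sub>1 \<prec> \<dots> \<prec> \<eta>\<^sub>K\<close> are the elements of a finite linearly ordered type \<open>'k\<close>, so that
  \<open>K = CARD('k) \<ge> 1\<close> and smaller means strictly preferred. The same type indexes vectors and
  matrices: the \<open>i\<close>-th component, for \<open>i\<close> from \<open>1\<close> to \<open>K\<close>, is the component at the
  \<open>i\<close>-th smallest element. Solutions are finite sets of elements of type \<open>'s\<close>.
\<close>

definition numerical_representations :: "('k::{finite,linorder} \<Rightarrow> nat) set" where
  "numerical_representations = {\<nu>. \<forall>i j. i < j \<longleftrightarrow> \<nu> i < \<nu> j}"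

definition value_of :: "('s \<Rightarrow> 'k) \<Rightarrow> ('k \<Rightarrow> nat) \<Rightarrow> 's set \<Rightarrow> nat" where
  "value_of cat \<nu> x = (\<Sum>e\<in>x. \<nu> (cat e))"

definition counting_vector :: "('s \<Rightarrow> 'k::finite) \<Rightarrow> 's set \<Rightarrow> int ^ 'k" where
  "counting_vector cat x = (\<chi> i. int (card {e \<in> x. cat e = i}))"

definition weakly_ordinally_dominates ::
    "('s \<Rightarrow> 'k::{finite,linorder}) \<Rightarrow> 's set \<Rightarrow> 's set \<Rightarrow> bool" where
  "weakly_ordinally_dominates cat x y \<longleftrightarrow>
     (\<forall>\<nu>\<in>numerical_representations. value_of cat \<nu> x \<le> value_of cat \<nu> y)"

definition ordinally_dominates ::
    "('s \<Rightarrow> 'k::{finite,linorder}) \<Rightarrow> 's set \<Rightarrow> 's set \<Rightarrow> bool" where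
  "ordinally_dominates cat x y \<longleftrightarrow> weakly_ordinally_dominates cat x y \<and>
     (\<exists>\<nu>\<in>numerical_representations. value_of cat \<nu> x < value_of cat \<nu> y)"

definition ordinally_efficient ::
    "('s \<Rightarrow> 'k::{finite,linorder}) \<Rightarrow> 's set set \<Rightarrow> 's set set" where
  "ordinally_efficient cat X = {x \<in> X. \<not> (\<exists>y\<in>X. ordinally_dominates cat y x)}"

definition tail_dominates ::
    "('s \<Rightarrow> 'k::{finite,linorder}) \<Rightarrow> 's set \<Rightarrow> 's set \<Rightarrow> bool" where
  "tail_dominates cat x y \<longleftrightarrow>
     (\<forall>j. (\<Sum>i\<in>{j..}. counting_vector cat x $ i) \<le> (\<Sum>i\<in>{j..}. counting_vector cat y $ i)) \<and>
     counting_vector cat x \<noteq> counting_vector cat y"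

definition tail_efficient ::
    "('s \<Rightarrow> 'k::{finite,linorder}) \<Rightarrow> 's set set \<Rightarrow> 's set set" where
  "tail_efficient cat X = {x \<in> X. \<not> (\<exists>y\<in>X. tail_dominates cat y x)}"

definition pareto_dominates :: "real ^ 'k \<Rightarrow> real ^ 'k \<Rightarrow> bool" where
  "pareto_dominates u v \<longleftrightarrow> (\<forall>i. u $ i \<le> v $ i) \<and> u \<noteq> v"

definition tail_matrix :: "real ^ 'k::{finite,linorder} ^ 'k::{finite,linorder}" where
  "tail_matrix = (\<chi> i j. if i \<le> j then 1 else 0)"

definition transformed_objective ::
    "('s \<Rightarrow> 'k::{finite,linorder}) \<Rightarrow> 's set \<Rightarrow> real ^ 'k::{finite,linorder}" where
  "transformed_objective cat x = tail_matrix *v (\<chi> i. real_of_int (counting_vector cat x $ i))"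

definition pareto_efficient ::
    "('s \<Rightarrow> 'k::{finite,linorder}) \<Rightarrow> 's set set \<Rightarrow> 's set set" where
  "pareto_efficient cat X =
     {x \<in> X. \<not> (\<exists>y\<in>X. pareto_dominates (transformed_objective cat y) (transformed_objective cat x))}"

end

theory Submission
  imports Defs
begin

text \<open>
  For finite solutions the three dominance relations coincide, which makes the three sets of
  efficient solutions equal for every \<open>X\<close>. Comparing \<open>x\<close> with \<open>y\<close> means looking
  at the integer vector \<open>u = c(y) - c(x)\<close>, and everything is expressed by its tail sums
  \<open>T\<^sub>j = \<Sum>\<^sub>i\<^sub>\<ge>\<^sub>j u\<^sub>i\<close>.

  Tail-dominance says that all \<open>T\<^sub>j\<close> are nonnegative and \<open>u \<noteq> 0\<close>. The rows of \<open>A\<close> are the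
  indicators of the tails, so \<open>A\<close> maps \<open>u\<close> to \<open>(T\<^sub>j)\<^sub>j\<close>; since the tail sums determine \<open>u\<close>
  (\<open>zero_if_tail_sums_zero\<close>), Pareto dominance for the transformed problem says the same.

  A numerical representation \<open>\<nu>\<close> turns the comparison into the sign of \<open>\<Sum>\<^sub>k \<nu>(k) u\<^sub>k\<close>. A monotone
  weight is a sum of indicators of its superlevel sets \<open>{k. t < \<nu>(k)}\<close>, and these are tails or empty, so
  nonnegative tail sums force every weighted sum to be nonnegative
  (\<open>weighted_sum_nonneg_if_tail_sums_nonneg\<close>). Conversely, the representations
  \<open>steep_representation N j\<close>, which add to the rank of a category a jump of height \<open>N\<close> at \<open>j\<close>,
  have weighted sum \<open>R + N T\<^sub>j\<close>, where \<open>R\<close> does not depend on \<open>N\<close>. Nonnegativity for large \<open>N\<close>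
  forces \<open>T\<^sub>j \<ge> 0\<close>, while \<open>N = 1\<close> detects strict inequality: when all tail sums are nonnegative
  and \<open>T\<^sub>j > 0\<close>, also \<open>R \<ge> 0\<close>, so \<open>R + T\<^sub>j > 0\<close>.
\<close>

lemma upward_closed_eq_atLeast:
  fixes U :: "'k::{finite,linorder} set"
  assumes "U \<noteq> {}" and "\<And>i j. i \<in> U \<Longrightarrow> i \<le> j \<Longrightarrow> j \<in> U"
  obtains m where "U = {m..}"
proof
  have "Min U \<in> U" using assms(1) by simp
  show "U = {Min U..}"
  proof
    show "U \<subseteq> {Min U..}" by auto
    show "{Min U..} \<subseteq> U"
    proof
      fix j
      assume "j \<in> {Min U..}"
      then have "Min U \<le> j" by simp
      with \<open>Min U \<in> U\<close> show "j \<in> U" by (rule assms(2))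
    qed
  qed
qed

text \<open>
  The set of categories strictly above \<open>k\<close> is again a tail or empty, so the \<open>k\<close>-th component is a
  difference of two vanishing tail sums.
\<close>

lemma zero_if_tail_sums_zero:
  fixes u :: "'k::{finite,linorder} \<Rightarrow> 'a::ab_group_add"
  assumes tails: "\<And>j. sum u {j..} = 0"
  shows "u k = 0"
proof -
  have "sum u {k<..} = 0"
  proof (cases "{k<..} = {}")
    case False
    then obtain m where "{k<..} = {m..}"
      by (rule upward_closed_eq_atLeast) auto
    then show ?thesis using tails by simp
  qed simp
  moreover have "{k..} = insert k {k<..}" by auto
  then have "sum u {k..} = u k + sum u {k<..}" by simp
  ultimately show ?thesis using tails[of k] by simp
qed

text \<open>
  A layer-cake form of summation by parts: writing \<open>\<nu>(k)\<close> as the number of thresholds below it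
  turns the weighted sum into a sum over thresholds of tail sums of \<open>u\<close>.
\<close>

lemma weighted_sum_nonneg_if_tail_sums_nonneg:
  fixes u :: "'k::{finite,linorder} \<Rightarrow> int" and \<nu> :: "'k \<Rightarrow> nat"
  assumes "mono \<nu>" and tails: "\<And>j. 0 \<le> sum u {j..}"
  shows "0 \<le> (\<Sum>k\<in>UNIV. int (\<nu> k) * u k)"
proof -
  define N where "N = Max (range \<nu>)"
  have layers: "int (\<nu> k) = (\<Sum>t<N. if t < \<nu> k then 1 else 0)" for k
  proof -
    have "\<nu> k \<le> N" by (simp add: N_def)
    then have "{..<N} \<inter> {t. t < \<nu> k} = {..<\<nu> k}" by auto
    then show ?thesis by (simp add: sum.If_cases)
  qed
  have "(\<Sum>k\<in>UNIV. int (\<nu> k) * u k) = (\<Sum>k\<in>UNIV. \<Sum>t<N. if t < \<nu> k then u k else 0)"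
    unfolding layers sum_distrib_right by (intro sum.cong) auto
  also have "\<dots> = (\<Sum>t<N. \<Sum>k\<in>UNIV. if t < \<nu> k then u k else 0)"
    by (rule sum.swap)
  also have "\<dots> = (\<Sum>t<N. sum u {k. t < \<nu> k})"
    by (simp add: sum.If_cases)
  also have "\<dots> \<ge> 0"
  proof (rule sum_nonneg)
    fix t
    show "0 \<le> sum u {k. t < \<nu> k}"
    proof (cases "{k. t < \<nu> k} = {}")
      case False
      then obtain m where "{k. t < \<nu> k} = {m..}"
      proof (rule upward_closed_eq_atLeast)
        fix i j
        assume "i \<in> {k. t < \<nu> k}" and "i \<le> j"
        then have "t < \<nu> i" and "\<nu> i \<le> \<nu> j" using monoD[OF \<open>mono \<nu>\<close>] by auto
        then show "j \<in> {k. t < \<nu> k}" by simp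
      qed
      then show ?thesis using tails by simp
    next
      case True
      then show ?thesis by (simp only: sum.empty)
    qed
  qed
  finally show ?thesis .
qed

lemma mono_numerical_representation:
  fixes \<nu> :: "'k::{finite,linorder} \<Rightarrow> nat"
  assumes "\<nu> \<in> numerical_representations"
  shows "mono \<nu>"
proof -
  have "strict_mono \<nu>"
    using assms by (simp add: numerical_representations_def strict_mono_def)
  then show ?thesis by (rule strict_mono_mono)
qed

text \<open>
  The indicator of the tail at \<open>j\<close> is not a numerical representation, because it is not
  strictly monotone; adding the rank repairs this, and a large \<open>N\<close> makes the repair negligible.
\<close>

definition steep_representation :: "nat \<Rightarrow> 'k::{finite,linorder} \<Rightarrow> 'k \<Rightarrow> nat" where
  "steep_representation N j k = card {..<k} + (if j \<le> k then N else 0)"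

lemma steep_representation_in_numerical_representations:
  fixes j :: "'k::{finite,linorder}"
  shows "steep_representation N j \<in> numerical_representations"
proof -
  have "strict_mono (steep_representation N j)"
  proof (rule strict_monoI)
    fix a b :: 'k
    assume "a < b"
    then have "{..<a} \<subset> {..<b}" by auto
    then have "card {..<a} < card {..<b}" by (simp add: psubset_card_mono)
    then show "steep_representation N j a < steep_representation N j b"
      using \<open>a < b\<close> by (auto simp: steep_representation_def)
  qed
  then show ?thesis
    by (simp add: numerical_representations_def strict_mono_less)
qed

lemma weighted_sum_steep_representation:
  fixes u :: "'k::{finite,linorder} \<Rightarrow> int"
  shows "(\<Sum>k\<in>UNIV. int (steep_representation N j k) * u k) =
         (\<Sum>k\<in>UNIV. int (card {..<k}) * u k) + int N * sum u {j..}"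
proof -
  have "(\<Sum>k\<in>UNIV. int (steep_representation N j k) * u k) =
        (\<Sum>k\<in>UNIV. int (card {..<k}) * u k + (if j \<le> k then int N * u k else 0))"
    by (intro sum.cong) (auto simp: steep_representation_def algebra_simps)
  also have "\<dots> = (\<Sum>k\<in>UNIV. int (card {..<k}) * u k) + (\<Sum>k\<in>{j..}. int N * u k)"
    by (simp add: sum.distrib sum.If_cases atLeast_def)
  finally show ?thesis by (simp add: sum_distrib_left)
qed

lemma value_of_eq_weighted_counting_vector:
  fixes cat :: "'s \<Rightarrow> 'k::{finite,linorder}"
  assumes "finite x"
  shows "int (value_of cat \<nu> x) = (\<Sum>k\<in>UNIV. int (\<nu> k) * counting_vector cat x $ k)"
proof -
  have "int (value_of cat \<nu> x) = (\<Sum>k\<in>UNIV. \<Sum>e | e \<in> x \<and> cat e = k. int (\<nu> (cat e)))"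
    using sum.group[OF assms finite, of cat UNIV "\<lambda>e. int (\<nu> (cat e))"]
    by (simp add: value_of_def)
  also have "\<dots> = (\<Sum>k\<in>UNIV. int (\<nu> k) * counting_vector cat x $ k)"
    by (simp add: counting_vector_def mult.commute)
  finally show ?thesis .
qed

lemma value_of_diff_eq_weighted_sum:
  fixes cat :: "'s \<Rightarrow> 'k::{finite,linorder}"
  assumes "finite x" and "finite y"
  shows "int (value_of cat \<nu> y) - int (value_of cat \<nu> x) =
         (\<Sum>k\<in>UNIV. int (\<nu> k) * (counting_vector cat y - counting_vector cat x) $ k)"
  using assms
  by (simp add: value_of_eq_weighted_counting_vector right_diff_distrib sum_subtractf)

lemma ordinally_dominates_iff_tail_dominates:
  fixes cat :: "'s \<Rightarrow> 'k::{finite,linorder}"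
  assumes fin: "finite x" "finite y"
  shows "ordinally_dominates cat x y \<longleftrightarrow> tail_dominates cat x y"
proof -
  define u where "u k = (counting_vector cat y - counting_vector cat x) $ k" for k
  define W where "W \<nu> = (\<Sum>k\<in>UNIV. int (\<nu> k) * u k)" for \<nu> :: "'k \<Rightarrow> nat"
  define R where "R = W (\<lambda>k. card {..<k})"
  have value_diff: "int (value_of cat \<nu> y) - int (value_of cat \<nu> x) = W \<nu>" for \<nu>
    using value_of_diff_eq_weighted_sum[OF fin] by (simp add: W_def u_def)
  have value_le: "value_of cat \<nu> x \<le> value_of cat \<nu> y \<longleftrightarrow> 0 \<le> W \<nu>"
    and value_less: "value_of cat \<nu> x < value_of cat \<nu> y \<longleftrightarrow> 0 < W \<nu>" for \<nu>
    using value_diff[of \<nu>] by linarith+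
  have W_steep: "W (steep_representation N j) = R + int N * sum u {j..}" for N j
    by (simp add: W_def R_def weighted_sum_steep_representation)
  have tail_dominates: "tail_dominates cat x y \<longleftrightarrow> (\<forall>j. 0 \<le> sum u {j..}) \<and> (\<exists>k. u k \<noteq> 0)"
    by (simp add: tail_dominates_def u_def sum_subtractf vec_eq_iff) metis
  have ordinally_dominates: "ordinally_dominates cat x y \<longleftrightarrow>
      (\<forall>\<nu>\<in>numerical_representations. 0 \<le> W \<nu>) \<and> (\<exists>\<nu>\<in>numerical_representations. 0 < W \<nu>)"
    by (simp add: ordinally_dominates_def weakly_ordinally_dominates_def value_le value_less)
  show ?thesis
  proof
    assume "ordinally_dominates cat x y"
    then have nonneg: "\<And>\<nu>. \<nu> \<in> numerical_representations \<Longrightarrow> 0 \<le> W \<nu>"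
      and "\<exists>\<nu>. 0 < W \<nu>"
      by (auto simp: ordinally_dominates)
    have "0 \<le> sum u {j..}" for j
    proof (rule ccontr)
      assume "\<not> 0 \<le> sum u {j..}"
      then have neg: "sum u {j..} \<le> -1" by simp
      \<comment> \<open>A jump higher than \<open>R\<close> outweighs the contribution of the ranks.\<close>
      define N where "N = nat (\<bar>R\<bar> + 1)"
      have "int N * sum u {j..} \<le> int N * (-1)"
        using neg by (intro mult_left_mono) auto
      then have "W (steep_representation N j) < 0"
        unfolding W_steep by (simp add: N_def)
      then show False
        using nonneg[OF steep_representation_in_numerical_representations, of N j] by simp
    qed
    moreover have "\<exists>k. u k \<noteq> 0"
    proof (rule ccontr)
      assume "\<nexists>k. u k \<noteq> 0"
      then have "W \<nu> = 0" for \<nu> by (simp add: W_def)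
      then show False using \<open>\<exists>\<nu>. 0 < W \<nu>\<close> by simp
    qed
    ultimately show "tail_dominates cat x y" by (simp add: tail_dominates)
  next
    assume "tail_dominates cat x y"
    then have tails: "\<And>j. 0 \<le> sum u {j..}" and "\<exists>k. u k \<noteq> 0"
      by (auto simp: tail_dominates)
    have nonneg: "0 \<le> W \<nu>" if "\<nu> \<in> numerical_representations" for \<nu>
      unfolding W_def
      using mono_numerical_representation[OF that] tails
      by (rule weighted_sum_nonneg_if_tail_sums_nonneg)
    obtain j where "sum u {j..} \<noteq> 0"
      using \<open>\<exists>k. u k \<noteq> 0\<close> zero_if_tail_sums_zero[of u] by blast
    then have "0 < sum u {j..}" using tails[of j] by simp
    \<comment> \<open>With jump height 0 the representation is the rank itself.\<close>
    moreover have "0 \<le> R"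
      using nonneg[OF steep_representation_in_numerical_representations, of 0 j] W_steep[of 0 j]
      by simp
    ultimately have "0 < W (steep_representation 1 j)"
      by (simp add: W_steep)
    then show "ordinally_dominates cat x y"
      using nonneg steep_representation_in_numerical_representations
      by (auto simp: ordinally_dominates)
  qed
qed

lemma transformed_objective_component:
  fixes cat :: "'s \<Rightarrow> 'k::{finite,linorder}"
  shows "transformed_objective cat x $ j = real_of_int (\<Sum>i\<in>{j..}. counting_vector cat x $ i)"
proof -
  have "transformed_objective cat x $ j =
        (\<Sum>i\<in>UNIV. if j \<le> i then real_of_int (counting_vector cat x $ i) else 0)"
    unfolding transformed_objective_def tail_matrix_def matrix_vector_mult_def
    by (auto intro!: sum.cong)
  then show ?thesis by (simp add: sum.If_cases atLeast_def)
qed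

lemma transformed_objective_eq_iff:
  fixes cat :: "'s \<Rightarrow> 'k::{finite,linorder}"
  shows "transformed_objective cat x = transformed_objective cat y \<longleftrightarrow>
         counting_vector cat x = counting_vector cat y"
proof
  assume "transformed_objective cat x = transformed_objective cat y"
  then have "transformed_objective cat x $ j = transformed_objective cat y $ j" for j
    by simp
  then have "(\<Sum>i\<in>{j..}. counting_vector cat x $ i - counting_vector cat y $ i) = 0" for j
    unfolding transformed_objective_component of_int_eq_iff by (simp add: sum_subtractf)
  then have "counting_vector cat x $ k - counting_vector cat y $ k = 0" for k
    by (rule zero_if_tail_sums_zero)
  then show "counting_vector cat x = counting_vector cat y"
    by (simp add: vec_eq_iff)
qed (simp add: transformed_objective_def)

lemma pareto_dominates_iff_tail_dominates:
  fixes cat :: "'s \<Rightarrow> 'k::{finite,linorder}"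
  shows "pareto_dominates (transformed_objective cat x) (transformed_objective cat y) \<longleftrightarrow>
         tail_dominates cat x y"
  unfolding pareto_dominates_def tail_dominates_def transformed_objective_eq_iff
    transformed_objective_component of_int_le_iff
  by (rule refl)

theorem theorem22:
  fixes S :: "'s set"
    and X :: "'s set set"
    and cat :: "'s \<Rightarrow> 'k::{finite,linorder}"
  assumes "X \<subseteq> Pow S"
    and "\<And>x. x \<in> X \<Longrightarrow> finite x"
  shows "ordinally_efficient cat X = tail_efficient cat X \<and>
         tail_efficient cat X = pareto_efficient cat X"
proof
  show "ordinally_efficient cat X = tail_efficient cat X"
    unfolding ordinally_efficient_def tail_efficient_def
    using assms(2) by (auto simp: ordinally_dominates_iff_tail_dominates)
  show "tail_efficient cat X = pareto_efficient cat X"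
    unfolding tail_efficient_def pareto_efficient_def pareto_dominates_iff_tail_dominates
    by (rule refl)
qed

end
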